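(* Suppose the functions $p_v$ ($v\in V$) satisfy Assumption 1 (stated in the context). Let $\boldsymbol z^*$ be an optimal solution of the problem (PA$'$), and let $x_v^*:=\bar\xi_v^{-1}\big(\sum_{e\in\delta(v)}z_e^*\big)$ for all $v\in V$. Then $(\boldsymbol x^*,\boldsymbol z^* )$ is an optimal solution of the problem (PA).
   Context: $G=(U,V,E)$ is a finite bipartite graph with edges $e=(u,v)$, $u\in U$, $v\in V$; $\delta(a)$ is the set of edges incident to node $a$, assumed non-empty for every $a\in U\cup V$. Each edge $e$ has a weight $w_e\in\mathbb R$; each $u\in U$ has a capacity $c_u\in\mathbb Z_{>0}$. For each $v\in V$: $n_v$ is a positive integer, $\mathcal X_v\subseteq\mathbb R$ is a non-empty interval, $p_v:\mathcal X_v\to\mathcal Z_v\subseteq[0,1]$ is a function, and $\bar\xi_v(x):=n_vp_v(x)$, a map from $\mathcal X_v$ to $n_v\mathcal Z_v:=\{n_vz:z\in\mathcal Z_v\}$. It is assumed that for each $v\in V$ there is $x_v\in\mathcal X_v$ with $x_v>-\max_{e\in\delta(v)}w_e$. Assumption 1. For all $v\in V$: (a) $p_v$ is differentiable, strictly decreasing, and bijective from $\mathcal X_v$ onto $\mathcal Z_v$; (b) if $\mathcal X_v$ is bounded from above, then $\max\mathcal X_v$ exists and $p_v(\max\mathcal X_v)=0$; if $\mathcal X_v$ is unbounded from above, then $\lim_{x\to\infty}p_v(x)=0$; (c) $p_v'(x)/p_v(x)$ is monotonically non-increasing on the interior of $\mathcal X_v$. Under Assumption 1, $\bar\xi_v$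 is a bijection from $\mathcal X_v$ onto $n_v\mathcal Z_v$ with inverse $\bar\xi_v^{-1}$. Problem (PA): maximize $\sum_{e=(u,v)\in E}(x_v+w_e)z_e$ over $\boldsymbol x\in\mathbb R^V$, $\boldsymbol z\in\mathbb R_{\ge0}^E$ subject to $x_v\in\mathcal X_v$ for all $v\in V$, $\sum_{e\in\delta(v)}z_e\le\bar\xi_v(x_v)$ for all $v\in V$, $\sum_{e\in\delta(u)}z_e\le c_u$ for all $u\in U$. Problem (PA$'$): maximize $\sum_{v\in V}\bar\xi_v^{-1}\big(\sum_{e\in\delta(v)}z_e\big)\sum_{e\in\delta(v)}z_e+\sum_{e\in E}w_ez_e$ over $\boldsymbol z\in\mathbb R_{\ge0}^E$ subject to $\sum_{e\in\delta(v)}z_e\in n_v\mathcal Z_v$ for all $v\in V$, $\sum_{e\in\delta(u)}z_e\le c_u$ for all $u\in U$. *)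

theory Defs
  imports "HOL-Analysis.Analysis"
begin

text \<open>
  Vectors indexed by the finite sets \<open>V\<close> and \<open>E\<close> are represented by total functions; only their
  values on \<open>V\<close> and \<open>E\<close> enter the constraints and objectives below. Similarly, \<open>p v\<close> is a total
  function of which only the restriction to \<open>X v\<close> matters.
\<close>

definition incident :: "('a \<times> 'a) set \<Rightarrow> 'a \<Rightarrow> ('a \<times> 'a) set" where
  "incident E a = {e \<in> E. fst e = a \<or> snd e = a}"

locale bipartite_graph =
  fixes U V :: "'a set" and E :: "('a \<times> 'a) set"
  assumes finite_U: "finite U"
    and finite_V: "finite V"
    and disjoint: "U \<inter> V = {}"
    and edges: "E \<subseteq> U \<times> V"
    and incident_nonempty: "\<And>a. a \<in> U \<union> V \<Longrightarrow> incident E a \<noteq> {}"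

locale pricing_instance = bipartite_graph U V E
  for U V :: "'a set" and E :: "('a \<times> 'a) set" +
  fixes w :: "'a \<times> 'a \<Rightarrow> real"
    and c :: "'a \<Rightarrow> int"
    and n :: "'a \<Rightarrow> nat"
    and X Z :: "'a \<Rightarrow> real set"
    and p :: "'a \<Rightarrow> real \<Rightarrow> real"
  assumes capacity_pos: "\<And>u. u \<in> U \<Longrightarrow> c u > 0"
    and n_pos: "\<And>v. v \<in> V \<Longrightarrow> n v > 0"
    and X_nonempty: "\<And>v. v \<in> V \<Longrightarrow> X v \<noteq> {}"
    and X_interval: "\<And>v. v \<in> V \<Longrightarrow> is_interval (X v)"
    and Z_unit: "\<And>v. v \<in> V \<Longrightarrow> Z v \<subseteq> {0..1}"
    and p_maps: "\<And>v. v \<in> V \<Longrightarrow> p v ` X v \<subseteq> Z v"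
    and profitable: "\<And>v. v \<in> V \<Longrightarrow> \<exists>x\<in>X v. x > - Max (w ` incident E v)"

text \<open>
  Differentiability on \<open>X\<close> is one-sided at those endpoints of the interval that belong to it.
\<close>

definition assumption1 :: "real set \<Rightarrow> real set \<Rightarrow> (real \<Rightarrow> real) \<Rightarrow> bool" where
  "assumption1 X Z p \<longleftrightarrow>
     (p differentiable_on X \<and> strict_antimono_on X p \<and> bij_betw p X Z) \<and>
     (if bdd_above X then \<exists>m\<in>X. (\<forall>x\<in>X. x \<le> m) \<and> p m = 0 else (p \<longlongrightarrow> 0) at_top) \<and>
     antimono_on (interior X) (\<lambda>x. deriv p x / p x)"

definition xi_bar :: "('a \<Rightarrow> nat) \<Rightarrow> ('a \<Rightarrow> real \<Rightarrow> real) \<Rightarrow> 'a \<Rightarrow> real \<Rightarrow> real" where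
  "xi_bar n p v x = real (n v) * p v x"

definition xi_bar_inv ::
  "('a \<Rightarrow> nat) \<Rightarrow> ('a \<Rightarrow> real set) \<Rightarrow> ('a \<Rightarrow> real \<Rightarrow> real) \<Rightarrow> 'a \<Rightarrow> real \<Rightarrow> real" where
  "xi_bar_inv n X p v = inv_into (X v) (xi_bar n p v)"

definition PA_feasible ::
  "'a set \<Rightarrow> 'a set \<Rightarrow> ('a \<times> 'a) set \<Rightarrow> ('a \<Rightarrow> int) \<Rightarrow> ('a \<Rightarrow> nat) \<Rightarrow> ('a \<Rightarrow> real set) \<Rightarrow>
   ('a \<Rightarrow> real \<Rightarrow> real) \<Rightarrow> ('a \<Rightarrow> real) \<times> ('a \<times> 'a \<Rightarrow> real) \<Rightarrow> bool" where
  "PA_feasible U V E c n X p = (\<lambda>(x, z).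
     (\<forall>e\<in>E. z e \<ge> 0) \<and>
     (\<forall>v\<in>V. x v \<in> X v) \<and>
     (\<forall>v\<in>V. (\<Sum>e\<in>incident E v. z e) \<le> xi_bar n p v (x v)) \<and>
     (\<forall>u\<in>U. (\<Sum>e\<in>incident E u. z e) \<le> of_int (c u)))"

definition PA_objective ::
  "('a \<times> 'a) set \<Rightarrow> ('a \<times> 'a \<Rightarrow> real) \<Rightarrow> ('a \<Rightarrow> real) \<times> ('a \<times> 'a \<Rightarrow> real) \<Rightarrow> real" where
  "PA_objective E w = (\<lambda>(x, z). \<Sum>(u, v)\<in>E. (x v + w (u, v)) * z (u, v))"

definition PA'_feasible ::
  "'a set \<Rightarrow> 'a set \<Rightarrow> ('a \<times> 'a) set \<Rightarrow> ('a \<Rightarrow> int) \<Rightarrow> ('a \<Rightarrow> nat) \<Rightarrow> ('a \<Rightarrow> real set) \<Rightarrow>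
   ('a \<times> 'a \<Rightarrow> real) \<Rightarrow> bool" where
  "PA'_feasible U V E c n Z z \<longleftrightarrow>
     (\<forall>e\<in>E. z e \<ge> 0) \<and>
     (\<forall>v\<in>V. (\<Sum>e\<in>incident E v. z e) \<in> (\<lambda>t. real (n v) * t) ` Z v) \<and>
     (\<forall>u\<in>U. (\<Sum>e\<in>incident E u. z e) \<le> of_int (c u))"

definition PA'_objective ::
  "'a set \<Rightarrow> ('a \<times> 'a) set \<Rightarrow> ('a \<times> 'a \<Rightarrow> real) \<Rightarrow> ('a \<Rightarrow> nat) \<Rightarrow> ('a \<Rightarrow> real set) \<Rightarrow>
   ('a \<Rightarrow> real \<Rightarrow> real) \<Rightarrow> ('a \<times> 'a \<Rightarrow> real) \<Rightarrow> real" where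
  "PA'_objective V E w n X p z =
     (\<Sum>v\<in>V. xi_bar_inv n X p v (\<Sum>e\<in>incident E v. z e) * (\<Sum>e\<in>incident E v. z e)) +
     (\<Sum>e\<in>E. w e * z e)"

end

theory Submission
  imports Defs
begin

text \<open>
  For fixed sales \<open>z \<ge> 0\<close>, the (PA) objective is nondecreasing in each price, and if demand
  attains the sales level at \<open>v\<close>, the largest price supporting this level is the market-clearing
  one. Hence (PA') is (PA) with the prices eliminated (\<open>PA_objective_le_PA'_objective\<close>,
  \<open>clearing_prices_optimal\<close>), and the two problems could differ only in which sales vectors they
  admit.

  They do differ: when \<open>X v\<close> is unbounded above, demand approaches zero without attaining it, so
  (PA) allows zero sales at \<open>v\<close> whereas (PA') does not. Every other sales level that some price
  supports is attained exactly, by the intermediate value theorem (\<open>demand_level_attained\<close>). The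
  gap is harmless because (PA) is convex in \<open>z\<close> once \<open>x\<close> is fixed: moving from a feasible \<open>z\<close>
  slightly towards a feasible vector that sells at every node of \<open>V\<close> with positive demand at \<open>x\<close>
  (\<open>spread_feasible\<close>) yields vectors that (PA') admits. Along this segment the (PA)
  objective is affine and bounded by the (PA') optimum, hence so is its value at the end point \<open>z\<close>.
\<close>

section \<open>Attained demand levels\<close>

text \<open>
  Demand falls to zero, or arbitrarily close to it, as the price rises, so continuity makes it pass
  through every positive level below its current value. The level zero need not be attained.
\<close>

lemma demand_level_attained:
  assumes reg: "assumption1 X Z p" and int: "is_interval X" and x: "x \<in> X"
    and t: "0 < t" "t \<le> p x"
  shows "t \<in> Z"
proof -
  have cont: "continuous_on X p" and bij: "bij_betw p X Z"
    using reg by (auto simp: assumption1_def differentiable_imp_continuous_on)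
  have "\<exists>y\<in>X. x \<le> y \<and> p y \<le> t"
  proof (cases "bdd_above X")
    case True
    then obtain m where "m \<in> X" "\<forall>y\<in>X. y \<le> m" "p m = 0"
      using reg by (auto simp: assumption1_def split: if_splits)
    then show ?thesis using x t(1) by (intro bexI[of _ m]) auto
  next
    case False
    then have "(p \<longlongrightarrow> 0) at_top" using reg by (simp add: assumption1_def)
    then have "eventually (\<lambda>y. p y < t) at_top" using t(1) by (rule order_tendstoD(2))
    then obtain N where N: "\<And>y. y \<ge> N \<Longrightarrow> p y < t" by (auto simp: eventually_at_top_linorder)
    obtain y where "y \<in> X" "y > max N x"
      using False unfolding bdd_above_def by (meson not_le)
    then show ?thesis using N[of y] by (intro bexI[of _ y]) auto
  qed
  then obtain y where y: "y \<in> X" "x \<le> y" "p y \<le> t" by blast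
  have sub: "{x..y} \<subseteq> X"
    using mem_is_interval_1_I[OF int x y(1)] by auto
  obtain s where "x \<le> s" "s \<le> y" "p s = t"
    using IVT2'[OF y(3) t(2) y(2) continuous_on_subset[OF cont sub]] by blast
  then show ?thesis using sub bij by (auto simp: bij_betw_def)
qed

section \<open>Summation over the incident edges\<close>

context bipartite_graph
begin

lemma finite_E: "finite E"
  using finite_subset[OF edges] finite_U finite_V by blast

lemma incident_subset: "incident E a \<subseteq> E"
  by (auto simp: incident_def)

lemma finite_incident: "finite (incident E a)"
  using finite_subset[OF incident_subset finite_E] .

lemma incident_V: "v \<in> V \<Longrightarrow> incident E v = {e \<in> E. snd e = v}"
  using edges disjoint by (auto simp: incident_def)

lemma PA_objective_by_nodes:
  "PA_objective E w (x, z) = (\<Sum>v\<in>V. x v * (\<Sum>e\<in>incident E v. z e)) + (\<Sum>e\<in>E. w e * z e)"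
proof -
  have "(\<Sum>v\<in>V. x v * (\<Sum>e\<in>incident E v. z e)) = (\<Sum>v\<in>V. \<Sum>e\<in>{e \<in> E. snd e = v}. x (snd e) * z e)"
    by (intro sum.cong refl) (simp add: incident_V sum_distrib_left)
  also have "\<dots> = (\<Sum>e\<in>E. x (snd e) * z e)"
    using edges by (intro sum.group finite_E finite_V) auto
  finally show ?thesis
    by (simp add: PA_objective_def case_prod_unfold sum.distrib distrib_right)
qed

lemma sum_incident_le:
  fixes y :: "'a \<times> 'a \<Rightarrow> real"
  assumes "\<And>e. e \<in> incident E a \<Longrightarrow> y e \<le> b / card E" and "b \<ge> 0"
  shows "(\<Sum>e\<in>incident E a. y e) \<le> b"
proof -
  have "(\<Sum>e\<in>incident E a. y e) \<le> card (incident E a) * (b / card E)"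
    using assms(1) by (rule sum_bounded_above)
  also have "\<dots> \<le> card E * (b / card E)"
    using assms(2) card_mono[OF finite_E incident_subset] by (intro mult_right_mono) auto
  also have "\<dots> \<le> b" using assms(2) by simp
  finally show ?thesis .
qed

end

lemma PA_objective_affine:
  "PA_objective E w (x, \<lambda>e. (1 - s) * z e + s * y e) =
     (1 - s) * PA_objective E w (x, z) + s * PA_objective E w (x, y)"
  unfolding PA_objective_def case_prod_unfold prod.case sum_distrib_left sum.distrib[symmetric]
  by (rule sum.cong) (simp_all add: algebra_simps)

lemma PA_feasible_convex:
  assumes "PA_feasible U V E c n X p (x, z)" "PA_feasible U V E c n X p (x, y)"
    and s: "0 \<le> s" "s \<le> 1"
  shows "PA_feasible U V E c n X p (x, \<lambda>e. (1 - s) * z e + s * y e)"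
proof -
  have "(1 - s) * a + s * b \<le> d" if "a \<le> d" "b \<le> d" for a b d :: real
    using convex_bound_le[OF that, of "1 - s" s] s by simp
  then show ?thesis
    using assms by (auto simp: PA_feasible_def sum.distrib sum_distrib_left[symmetric])
qed

section \<open>Elimination of the prices\<close>

locale regular_pricing_instance = pricing_instance +
  assumes regular: "\<And>v. v \<in> V \<Longrightarrow> assumption1 (X v) (Z v) (p v)"
begin

lemma xi_bar_image: "v \<in> V \<Longrightarrow> xi_bar n p v ` X v = (\<lambda>t. real (n v) * t) ` Z v"
  using regular[of v]
  by (simp add: assumption1_def bij_betw_def xi_bar_def[abs_def] flip: image_image)

lemma xi_bar_nonneg: "v \<in> V \<Longrightarrow> x \<in> X v \<Longrightarrow> xi_bar n p v x \<ge> 0"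
  using p_maps[of v] Z_unit[of v] by (fastforce simp: xi_bar_def)

lemma clearing_price:
  assumes "v \<in> V" "s \<in> (\<lambda>t. real (n v) * t) ` Z v"
  shows "xi_bar_inv n X p v s \<in> X v" "xi_bar n p v (xi_bar_inv n X p v s) = s"
  using assms by (auto simp: xi_bar_inv_def xi_bar_image[symmetric] inv_into_into f_inv_into_f)

lemma le_clearing_price:
  assumes "v \<in> V" "s \<in> (\<lambda>t. real (n v) * t) ` Z v" "x \<in> X v" "s \<le> xi_bar n p v x"
  shows "x \<le> xi_bar_inv n X p v s"
proof (rule ccontr)
  assume "\<not> x \<le> xi_bar_inv n X p v s"
  then have "p v x < p v (xi_bar_inv n X p v s)"
    using regular[OF assms(1)] clearing_price(1)[OF assms(1,2)] assms(3)
    by (auto simp: assumption1_def monotone_on_def)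
  then have "xi_bar n p v x < xi_bar n p v (xi_bar_inv n X p v s)"
    using n_pos[OF assms(1)] by (simp add: xi_bar_def)
  then show False using clearing_price(2)[OF assms(1,2)] assms(4) by simp
qed

lemma PA_objective_le_PA'_objective:
  assumes "PA_feasible U V E c n X p (x, z)" "PA'_feasible U V E c n Z z"
  shows "PA_objective E w (x, z) \<le> PA'_objective V E w n X p z"
proof -
  have "x v * (\<Sum>e\<in>incident E v. z e)
      \<le> xi_bar_inv n X p v (\<Sum>e\<in>incident E v. z e) * (\<Sum>e\<in>incident E v. z e)"
    if v: "v \<in> V" for v
  proof (rule mult_right_mono)
    show "x v \<le> xi_bar_inv n X p v (\<Sum>e\<in>incident E v. z e)"
      using assms v by (intro le_clearing_price) (auto simp: PA_feasible_def PA'_feasible_def)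
    show "0 \<le> (\<Sum>e\<in>incident E v. z e)"
      using assms(1) incident_subset by (intro sum_nonneg) (auto simp: PA_feasible_def)
  qed
  then show ?thesis
    unfolding PA_objective_by_nodes PA'_objective_def by (intro add_right_mono sum_mono)
qed

section \<open>Approximation by sales vectors with attained demand\<close>

text \<open>
  The weights are chosen so that a node serves at most its demand if it lies in \<open>V\<close>, and at most one
  unit, hence no more than its integral capacity, if it lies in \<open>U\<close>. The point of this vector is that
  it sells a positive amount wherever demand is positive.
\<close>

definition spread :: "('a \<Rightarrow> real) \<Rightarrow> 'a \<times> 'a \<Rightarrow> real" where
  "spread x e = min 1 (xi_bar n p (snd e) (x (snd e))) / card E"

lemma spread_nonneg:
  assumes "\<And>v. v \<in> V \<Longrightarrow> x v \<in> X v" "e \<in> E"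
  shows "spread x e \<ge> 0"
  using assms edges xi_bar_nonneg[of "snd e" "x (snd e)"] by (auto simp: spread_def)

lemma spread_feasible:
  assumes x: "\<And>v. v \<in> V \<Longrightarrow> x v \<in> X v"
  shows "PA_feasible U V E c n X p (x, spread x)"
proof -
  have "(\<Sum>e\<in>incident E v. spread x e) \<le> xi_bar n p v (x v)" if v: "v \<in> V" for v
    using xi_bar_nonneg[OF v x[OF v]] v
    by (intro sum_incident_le) (auto simp: incident_V spread_def intro!: divide_right_mono)
  moreover have "(\<Sum>e\<in>incident E u. spread x e) \<le> of_int (c u)" if u: "u \<in> U" for u
  proof -
    have "(\<Sum>e\<in>incident E u. spread x e) \<le> 1"
      by (intro sum_incident_le) (auto simp: spread_def intro!: divide_right_mono)
    also have "1 \<le> real_of_int (c u)" using capacity_pos[OF u] by simp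
    finally show ?thesis .
  qed
  ultimately show ?thesis
    using x spread_nonneg[of x] by (auto simp: PA_feasible_def)
qed

lemma spread_sum_pos:
  assumes v: "v \<in> V" and pos: "xi_bar n p v (x v) > 0"
  shows "(\<Sum>e\<in>incident E v. spread x e) > 0"
proof (rule sum_pos)
  show "incident E v \<noteq> {}" using incident_nonempty v by simp
  show "spread x e > 0" if "e \<in> incident E v" for e
  proof -
    have "e \<in> E" "snd e = v" using that v by (auto simp: incident_V)
    moreover from this have "card E > 0" using finite_E by (auto simp: card_gt_0_iff)
    ultimately show ?thesis using pos by (simp add: spread_def)
  qed
qed (rule finite_incident)

text \<open>
  The mixture inherits the constraints of (PA) by convexity, and the positive share of the spread
  vector rules out zero sales wherever demand is positive, the one case in which a level may fail
  to be attained.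
\<close>

lemma mixture_PA'_feasible:
  assumes feas: "PA_feasible U V E c n X p (x, z)" and s: "0 < s" "s \<le> 1"
  shows "PA'_feasible U V E c n Z (\<lambda>e. (1 - s) * z e + s * spread x e)"
proof -
  let ?y = "\<lambda>e. (1 - s) * z e + s * spread x e"
  have x: "x v \<in> X v" if "v \<in> V" for v
    using feas that by (auto simp: PA_feasible_def)
  have feas': "PA_feasible U V E c n X p (x, ?y)"
    using PA_feasible_convex[OF feas spread_feasible] x s by simp
  have "(\<Sum>e\<in>incident E v. ?y e) \<in> (\<lambda>t. real (n v) * t) ` Z v" if v: "v \<in> V" for v
  proof -
    let ?S = "\<Sum>e\<in>incident E v. ?y e"
    have le: "?S \<le> xi_bar n p v (x v)" using feas' v by (auto simp: PA_feasible_def)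
    have ynn: "0 \<le> ?S"
      using feas' incident_subset by (intro sum_nonneg) (auto simp: PA_feasible_def)
    show ?thesis
    proof (cases "xi_bar n p v (x v) > 0")
      case True
      have "0 \<le> (\<Sum>e\<in>incident E v. z e)"
        using feas incident_subset by (intro sum_nonneg) (auto simp: PA_feasible_def)
      then have "?S > 0"
        using spread_sum_pos[of v x, OF v True] s
        by (simp add: sum.distrib sum_distrib_left[symmetric] add_nonneg_pos)
      then have "?S / n v \<in> Z v"
        using le n_pos[OF v]
        by (intro demand_level_attained[OF regular[OF v] X_interval[OF v] x[OF v]])
          (auto simp: xi_bar_def field_simps)
      then show ?thesis using n_pos[OF v] by (intro image_eqI[of _ _ "?S / n v"]) auto
    next
      \<comment> \<open>Without demand there are no sales, and the level zero is attained at the price \<open>x v\<close>.\<close>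
      case False
      then have "?S = xi_bar n p v (x v)" using le ynn by linarith
      then show ?thesis using x[OF v] xi_bar_image[OF v] by auto
    qed
  qed
  then show ?thesis using feas' by (auto simp: PA_feasible_def PA'_feasible_def)
qed

text \<open>
  Since \<open>z\<close> itself may be inadmissible in (PA'), the bound is transferred from the mixtures by
  letting the share \<open>s\<close> of the spread vector tend to zero with the prices kept fixed.
\<close>

lemma PA_objective_le_PA'_bound:
  assumes feas: "PA_feasible U V E c n X p (x, z)"
    and bound: "\<And>y. PA'_feasible U V E c n Z y \<Longrightarrow> PA'_objective V E w n X p y \<le> M"
  shows "PA_objective E w (x, z) \<le> M"
proof -
  let ?f = "\<lambda>s. (1 - s) * PA_objective E w (x, z) + s * PA_objective E w (x, spread x)"
  have le: "?f s \<le> M" if s: "0 < s" "s < 1" for s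
  proof -
    let ?y = "\<lambda>e. (1 - s) * z e + s * spread x e"
    have "PA_feasible U V E c n X p (x, ?y)"
      using feas s by (intro PA_feasible_convex spread_feasible) (auto simp: PA_feasible_def)
    moreover have "PA'_feasible U V E c n Z ?y"
      using feas s by (intro mixture_PA'_feasible) auto
    ultimately have "PA_objective E w (x, ?y) \<le> M"
      using PA_objective_le_PA'_objective bound by (meson order_trans)
    then show ?thesis by (simp add: PA_objective_affine)
  qed
  have "(?f \<longlongrightarrow> ?f 0) (at_right 0)" by (intro tendsto_intros)
  moreover have "eventually (\<lambda>s. ?f s \<le> M) (at_right 0)"
    using le by (auto simp: eventually_at_right_field intro!: exI[of _ 1])
  ultimately have "?f 0 \<le> M" by (intro tendsto_upperbound) auto
  then show ?thesis by simp
qed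

lemma clearing_prices_optimal:
  assumes opt: "is_arg_max (PA'_objective V E w n X p) (PA'_feasible U V E c n Z) z"
    and x: "\<And>v. v \<in> V \<Longrightarrow> x v = xi_bar_inv n X p v (\<Sum>e\<in>incident E v. z e)"
  shows "is_arg_max (PA_objective E w) (PA_feasible U V E c n X p) (x, z)"
proof -
  have feas': "PA'_feasible U V E c n Z z"
    and best: "\<And>y. PA'_feasible U V E c n Z y \<Longrightarrow>
      PA'_objective V E w n X p y \<le> PA'_objective V E w n X p z"
    using opt by (auto simp: is_arg_max_def not_less)
  have "PA_feasible U V E c n X p (x, z)"
    using feas' clearing_price by (auto simp: PA_feasible_def PA'_feasible_def x)
  moreover have "PA_objective E w (x, z) = PA'_objective V E w n X p z"
    by (simp add: PA_objective_by_nodes PA'_objective_def x)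
  moreover have "PA_objective E w y \<le> PA'_objective V E w n X p z"
    if "PA_feasible U V E c n X p y" for y
    using PA_objective_le_PA'_bound[of "fst y" "snd y"] that best by simp
  ultimately show ?thesis by (auto simp: is_arg_max_def not_less)
qed

end

theorem theorem4:
  fixes U V :: "'a set" and E :: "('a \<times> 'a) set"
    and w :: "'a \<times> 'a \<Rightarrow> real" and c :: "'a \<Rightarrow> int" and n :: "'a \<Rightarrow> nat"
    and X Z :: "'a \<Rightarrow> real set" and p :: "'a \<Rightarrow> real \<Rightarrow> real"
    and x_star :: "'a \<Rightarrow> real" and z_star :: "'a \<times> 'a \<Rightarrow> real"
  assumes "pricing_instance U V E w c n X Z p"
    and "\<And>v. v \<in> V \<Longrightarrow> assumption1 (X v) (Z v) (p v)"
    and "is_arg_max (PA'_objective V E w n X p) (PA'_feasible U V E c n Z) z_star"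
    and "\<And>v. v \<in> V \<Longrightarrow> x_star v = xi_bar_inv n X p v (\<Sum>e\<in>incident E v. z_star e)"
  shows "is_arg_max (PA_objective E w) (PA_feasible U V E c n X p) (x_star, z_star)"
proof -
  interpret regular_pricing_instance U V E w c n X Z p
    using assms(1,2) by (intro regular_pricing_instance.intro regular_pricing_instance_axioms.intro)
  show ?thesis using clearing_prices_optimal assms(3,4) by blast
qed

end
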